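(* Let $T$ be a complete first-order theory in a countable language $\mathcal L$, all of whose models are infinite, and let $\phi(x,y)$ be an $\mathcal L$-formula with $|x|=|y|=1$ which defines a graph relation (a symmetric irreflexive binary relation) in every model of $T$. Assume $\phi(x,y)$ is stable in $T$. Fix $M\models T$ and a Keisler $\phi$-measure $\mu$ over $M$. Then for every $\epsilon>0$ there is some integer $m\geq 1$ such that for every $\gamma>0$ there is a partition $M=X_0\cup X_1\cup\ldots\cup X_m$ such that each $X_i$ is $\phi$-definable over $M$, $\mu(X_0)<\epsilon$, and for every $i\geq 1$, $X_i$ is $\gamma$-good in $(M,\phi)$ with respect to $\mu$.
   Context: $\phi(x,y)$ is $k$-stable in $T$ if $T$ proves there are no $x_1,\ldots,x_k,y_1,\ldots,y_k$ with $\phi(x_i,y_j)\leftrightarrow i\leq j$ for all $i,j\leq k$; it is stable if it is $k$-stable for some $k\geq 1$. A $\phi$-formula over $M$ is a finite Boolean combination of instances $\phi(x,b)$ with $b\in M$; a $\phi$-definable set is a subset of $M$ defined by a $\phi$-formula over $M$. A Keisler $\phi$-measure over $M$ is a finitely additive probability measure on the Boolean algebra of $\phi$-formulas over $M$ (equivalently of $\phi$-definable subsets of $M$): $\mu$ of an inconsistent formula is $0$, $\mu(\neg\theta)=1-\mu(\theta)$, and $\mu(\theta_1\vee\theta_2)=\mu(\theta_1)+\mu(\theta_2)-\mu(\theta_1\wedge\theta_2)$. For $X\subseteq M$ and $b\in M$, $\phi(X,b)=\{a\in X: M\models\phi(a,b)\}$. A $\phi$-definable set $X$ is $\gamma$-good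 in $(M,\phi)$ with respect to $\mu$ if for all $b\in M$, either $\mu(\phi(X,b))<\gamma\mu(X)$ or $\mu(\phi(X,b))>(1-\gamma)\mu(X)$. *)

theory Defs
  imports Complex_Main "HOL-Library.Countable_Set" "HOL-Library.Disjoint_Sets"
begin

section \<open>First-order logic with equality\<close>

text \<open>The symbols of a language are those in the sets \<open>funs\<close> and \<open>rels\<close>, so that either kind
  may be absent; elements of the types outside these sets are not symbols of the language.
  Constants are function symbols of arity 0.\<close>

record ('f, 'r) language =
  funs :: "'f set"
  rels :: "'r set"
  fun_arity :: "'f \<Rightarrow> nat"
  rel_arity :: "'r \<Rightarrow> nat"

definition countable_language :: "('f, 'r) language \<Rightarrow> bool" where
  "countable_language L \<longleftrightarrow> countable (funs L) \<and> countable (rels L)"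

datatype 'f fo_term = Var nat | App 'f "'f fo_term list"

datatype ('f, 'r) fo_formula =
    Equal "'f fo_term" "'f fo_term"
  | Rel 'r "'f fo_term list"
  | Neg "('f, 'r) fo_formula"
  | Conj "('f, 'r) fo_formula" "('f, 'r) fo_formula"
  | Exists nat "('f, 'r) fo_formula"

fun wf_term :: "('f, 'r) language \<Rightarrow> 'f fo_term \<Rightarrow> bool" where
  "wf_term L (Var v) \<longleftrightarrow> True"
| "wf_term L (App f ts) \<longleftrightarrow> f \<in> funs L \<and> length ts = fun_arity L f \<and> (\<forall>t\<in>set ts. wf_term L t)"

fun wf_formula :: "('f, 'r) language \<Rightarrow> ('f, 'r) fo_formula \<Rightarrow> bool" where
  "wf_formula L (Equal s t) \<longleftrightarrow> wf_term L s \<and> wf_term L t"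
| "wf_formula L (Rel r ts) \<longleftrightarrow> r \<in> rels L \<and> length ts = rel_arity L r \<and> (\<forall>t\<in>set ts. wf_term L t)"
| "wf_formula L (Neg \<phi>) \<longleftrightarrow> wf_formula L \<phi>"
| "wf_formula L (Conj \<phi> \<psi>) \<longleftrightarrow> wf_formula L \<phi> \<and> wf_formula L \<psi>"
| "wf_formula L (Exists v \<phi>) \<longleftrightarrow> wf_formula L \<phi>"

fun term_vars :: "'f fo_term \<Rightarrow> nat set" where
  "term_vars (Var v) = {v}"
| "term_vars (App f ts) = (\<Union>t\<in>set ts. term_vars t)"

fun free_vars :: "('f, 'r) fo_formula \<Rightarrow> nat set" where
  "free_vars (Equal s t) = term_vars s \<union> term_vars t"
| "free_vars (Rel r ts) = (\<Union>t\<in>set ts. term_vars t)"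
| "free_vars (Neg \<phi>) = free_vars \<phi>"
| "free_vars (Conj \<phi> \<psi>) = free_vars \<phi> \<union> free_vars \<psi>"
| "free_vars (Exists v \<phi>) = free_vars \<phi> - {v}"

definition sentences :: "('f, 'r) language \<Rightarrow> ('f, 'r) fo_formula set" where
  "sentences L = {\<sigma>. wf_formula L \<sigma> \<and> free_vars \<sigma> = {}}"

record ('f, 'r, 'a) interp =
  carrier :: "'a set"
  fun_int :: "'f \<Rightarrow> 'a list \<Rightarrow> 'a"
  rel_int :: "'r \<Rightarrow> 'a list \<Rightarrow> bool"

definition is_structure :: "('f, 'r) language \<Rightarrow> ('f, 'r, 'a) interp \<Rightarrow> bool" where
  "is_structure L M \<longleftrightarrow> carrier M \<noteq> {} \<and>
     (\<forall>f\<in>funs L. \<forall>as. length as = fun_arity L f \<and> set as \<subseteq> carrier M \<longrightarrow> fun_int M f as \<in> carrier M)"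

fun eval :: "('f, 'r, 'a) interp \<Rightarrow> (nat \<Rightarrow> 'a) \<Rightarrow> 'f fo_term \<Rightarrow> 'a" where
  "eval M e (Var v) = e v"
| "eval M e (App f ts) = fun_int M f (map (eval M e) ts)"

fun sat :: "('f, 'r, 'a) interp \<Rightarrow> (nat \<Rightarrow> 'a) \<Rightarrow> ('f, 'r) fo_formula \<Rightarrow> bool" where
  "sat M e (Equal s t) \<longleftrightarrow> eval M e s = eval M e t"
| "sat M e (Rel r ts) \<longleftrightarrow> rel_int M r (map (eval M e) ts)"
| "sat M e (Neg \<phi>) \<longleftrightarrow> \<not> sat M e \<phi>"
| "sat M e (Conj \<phi> \<psi>) \<longleftrightarrow> sat M e \<phi> \<and> sat M e \<psi>"
| "sat M e (Exists v \<phi>) \<longleftrightarrow> (\<exists>a\<in>carrier M. sat M (e(v := a)) \<phi>)"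

definition true_in :: "('f, 'r, 'a) interp \<Rightarrow> ('f, 'r) fo_formula \<Rightarrow> bool" where
  "true_in M \<sigma> \<longleftrightarrow> (\<forall>e. range e \<subseteq> carrier M \<longrightarrow> sat M e \<sigma>)"

definition is_model :: "('f, 'r) language \<Rightarrow> ('f, 'r) fo_formula set \<Rightarrow> ('f, 'r, 'a) interp \<Rightarrow> bool" where
  "is_model L T M \<longleftrightarrow> is_structure L M \<and> (\<forall>\<sigma>\<in>T. true_in M \<sigma>)"

text \<open>HOL cannot quantify over the models of a theory on all types at once. Below, \<open>every model\<close>
  ranges over the models whose carrier is any subset of a fixed type \<open>'a\<close>. For a countable language
  and an infinite type \<open>'a\<close> this is no restriction: all finite and all countable models have copies
  there, so by Loewenheim-Skolem a sentence true in all these models is true in all models,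
  and by Goedel's completeness theorem it is provable from the theory. Provability is
  accordingly rendered as truth in all models.\<close>

definition entails ::
    "'a itself \<Rightarrow> ('f, 'r) language \<Rightarrow> ('f, 'r) fo_formula set \<Rightarrow> ('f, 'r) fo_formula \<Rightarrow> bool" where
  "entails _ L T \<sigma> \<longleftrightarrow> (\<forall>N :: ('f, 'r, 'a) interp. is_model L T N \<longrightarrow> true_in N \<sigma>)"

definition complete_theory ::
    "'a itself \<Rightarrow> ('f, 'r) language \<Rightarrow> ('f, 'r) fo_formula set \<Rightarrow> bool" where
  "complete_theory U L T \<longleftrightarrow> T \<subseteq> sentences L \<and> (\<exists>N :: ('f, 'r, 'a) interp. is_model L T N) \<and>
     (\<forall>\<sigma>\<in>sentences L. entails U L T \<sigma> \<or> entails U L T (Neg \<sigma>))"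

definition all_models_infinite ::
    "'a itself \<Rightarrow> ('f, 'r) language \<Rightarrow> ('f, 'r) fo_formula set \<Rightarrow> bool" where
  "all_models_infinite _ L T \<longleftrightarrow> (\<forall>N :: ('f, 'r, 'a) interp. is_model L T N \<longrightarrow> infinite (carrier N))"

section \<open>Formulas in two variables\<close>

text \<open>A formula \<open>\<phi>(x,y)\<close> is given by \<open>\<phi>\<close> together with the indices of its two distinguished variables.\<close>

definition binary_formula ::
    "('f, 'r) language \<Rightarrow> ('f, 'r) fo_formula \<Rightarrow> nat \<Rightarrow> nat \<Rightarrow> bool" where
  "binary_formula L \<phi> x y \<longleftrightarrow> wf_formula L \<phi> \<and> x \<noteq> y \<and> free_vars \<phi> \<subseteq> {x, y}"

text \<open>\<open>M \<Turnstile> \<phi>(a,b)\<close>. The values of variables other than \<open>x\<close> and \<open>y\<close> are irrelevant.\<close>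

definition sat2 ::
    "('f, 'r, 'a) interp \<Rightarrow> ('f, 'r) fo_formula \<Rightarrow> nat \<Rightarrow> nat \<Rightarrow> 'a \<Rightarrow> 'a \<Rightarrow> bool" where
  "sat2 M \<phi> x y a b \<longleftrightarrow> sat M (\<lambda>v. if v = x then a else b) \<phi>"

definition defines_graph_in ::
    "('f, 'r, 'a) interp \<Rightarrow> ('f, 'r) fo_formula \<Rightarrow> nat \<Rightarrow> nat \<Rightarrow> bool" where
  "defines_graph_in M \<phi> x y \<longleftrightarrow>
     (\<forall>a\<in>carrier M. \<forall>b\<in>carrier M. sat2 M \<phi> x y a b \<longrightarrow> sat2 M \<phi> x y b a) \<and>
     (\<forall>a\<in>carrier M. \<not> sat2 M \<phi> x y a a)"

definition graph_formula ::
    "'a itself \<Rightarrow> ('f, 'r) language \<Rightarrow> ('f, 'r) fo_formula set \<Rightarrow> ('f, 'r) fo_formula \<Rightarrow> nat \<Rightarrow> nat \<Rightarrow> bool" where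
  "graph_formula _ L T \<phi> x y \<longleftrightarrow>
     (\<forall>N :: ('f, 'r, 'a) interp. is_model L T N \<longrightarrow> defines_graph_in N \<phi> x y)"

definition k_stable ::
    "'a itself \<Rightarrow> ('f, 'r) language \<Rightarrow> ('f, 'r) fo_formula set \<Rightarrow> nat \<Rightarrow> ('f, 'r) fo_formula \<Rightarrow> nat \<Rightarrow> nat \<Rightarrow> bool" where
  "k_stable _ L T k \<phi> x y \<longleftrightarrow>
     (\<forall>N :: ('f, 'r, 'a) interp. is_model L T N \<longrightarrow>
        \<not> (\<exists>a b :: nat \<Rightarrow> 'a. a ` {1..k} \<subseteq> carrier N \<and> b ` {1..k} \<subseteq> carrier N \<and>
              (\<forall>i\<in>{1..k}. \<forall>j\<in>{1..k}. sat2 N \<phi> x y (a i) (b j) \<longleftrightarrow> i \<le> j)))"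

definition stable_formula ::
    "'a itself \<Rightarrow> ('f, 'r) language \<Rightarrow> ('f, 'r) fo_formula set \<Rightarrow> ('f, 'r) fo_formula \<Rightarrow> nat \<Rightarrow> nat \<Rightarrow> bool" where
  "stable_formula U L T \<phi> x y \<longleftrightarrow> (\<exists>k\<ge>1. k_stable U L T k \<phi> x y)"

section \<open>Local formulas, Keisler measures and good sets\<close>

text \<open>\<open>Inst b\<close> stands for the instance \<open>\<phi>(x,b)\<close> of the fixed formula \<open>\<phi>\<close>.\<close>

datatype 'a phi_formula =
    Inst 'a
  | PNot "'a phi_formula"
  | PAnd "'a phi_formula" "'a phi_formula"
  | POr "'a phi_formula" "'a phi_formula"

fun sat_phi ::
    "('f, 'r, 'a) interp \<Rightarrow> ('f, 'r) fo_formula \<Rightarrow> nat \<Rightarrow> nat \<Rightarrow> 'a \<Rightarrow> 'a phi_formula \<Rightarrow> bool" where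
  "sat_phi M \<phi> x y a (Inst b) \<longleftrightarrow> sat2 M \<phi> x y a b"
| "sat_phi M \<phi> x y a (PNot \<theta>) \<longleftrightarrow> \<not> sat_phi M \<phi> x y a \<theta>"
| "sat_phi M \<phi> x y a (PAnd \<theta> \<eta>) \<longleftrightarrow> sat_phi M \<phi> x y a \<theta> \<and> sat_phi M \<phi> x y a \<eta>"
| "sat_phi M \<phi> x y a (POr \<theta> \<eta>) \<longleftrightarrow> sat_phi M \<phi> x y a \<theta> \<or> sat_phi M \<phi> x y a \<eta>"

definition phi_definable ::
    "('f, 'r, 'a) interp \<Rightarrow> ('f, 'r) fo_formula \<Rightarrow> nat \<Rightarrow> nat \<Rightarrow> 'a set \<Rightarrow> bool" where
  "phi_definable M \<phi> x y X \<longleftrightarrow>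
     (\<exists>\<theta>. set_phi_formula \<theta> \<subseteq> carrier M \<and> X = {a \<in> carrier M. sat_phi M \<phi> x y a \<theta>})"

text \<open>A Keisler measure is taken on the Boolean algebra of \<open>\<phi>\<close>-definable sets; its values on other
  sets carry no meaning.\<close>

definition keisler_measure ::
    "('f, 'r, 'a) interp \<Rightarrow> ('f, 'r) fo_formula \<Rightarrow> nat \<Rightarrow> nat \<Rightarrow> ('a set \<Rightarrow> real) \<Rightarrow> bool" where
  "keisler_measure M \<phi> x y \<mu> \<longleftrightarrow>
     (\<forall>X. phi_definable M \<phi> x y X \<longrightarrow> \<mu> X \<in> {0..1}) \<and>
     \<mu> {} = 0 \<and>
     (\<forall>X. phi_definable M \<phi> x y X \<longrightarrow> \<mu> (carrier M - X) = 1 - \<mu> X) \<and>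
     (\<forall>X Y. phi_definable M \<phi> x y X \<and> phi_definable M \<phi> x y Y \<longrightarrow>
        \<mu> (X \<union> Y) = \<mu> X + \<mu> Y - \<mu> (X \<inter> Y))"

definition phi_fiber ::
    "('f, 'r, 'a) interp \<Rightarrow> ('f, 'r) fo_formula \<Rightarrow> nat \<Rightarrow> nat \<Rightarrow> 'a set \<Rightarrow> 'a \<Rightarrow> 'a set" where
  "phi_fiber M \<phi> x y X b = {a \<in> X. sat2 M \<phi> x y a b}"

definition good ::
    "('f, 'r, 'a) interp \<Rightarrow> ('f, 'r) fo_formula \<Rightarrow> nat \<Rightarrow> nat \<Rightarrow> ('a set \<Rightarrow> real) \<Rightarrow> real \<Rightarrow> 'a set \<Rightarrow> bool" where
  "good M \<phi> x y \<mu> \<gamma> X \<longleftrightarrow> phi_definable M \<phi> x y X \<and>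
     (\<forall>b\<in>carrier M. \<mu> (phi_fiber M \<phi> x y X b) < \<gamma> * \<mu> X \<or>
                    \<mu> (phi_fiber M \<phi> x y X b) > (1 - \<gamma>) * \<mu> X)"

end

theory Submission
  imports Defs "HOL-Analysis.Sigma_Algebra"
begin

text \<open>
  Stability bounds the height of the binary trees of instances \<open>\<phi>(x,b)\<close> that are consistent inside
  \<open>M\<close>. By induction on this bound, \<open>\<mu>\<close> restricted to a \<open>\<phi>\<close>-definable set is, up to an
  arbitrarily small error, a finite sum \<open>\<Sum> \<alpha>\<^sub>i p\<^sub>i\<close> of weighted \<open>\<phi>\<close>-types: if \<open>X\<close> admits no tree of
  height \<open>n + 1\<close>, then each \<open>b\<close> has a side of \<open>X\<close> that admits no tree of height \<open>n\<close>; the opposite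
  sides generate a single (possibly inconsistent) type, its weight is the infimum of the measures
  of their finite intersections, and what they omit is covered by the induction hypothesis.
  The number of types depends only on \<open>\<epsilon>\<close>; for given \<open>\<gamma>\<close> one takes disjoint members of these types
  whose measures are close enough to the weights \<open>\<alpha>\<^sub>i\<close>.
\<close>

section \<open>Ladders and trees\<close>

text \<open>This is Shelah's local 2-rank: a tree of height \<open>n\<close> exists iff the rank of
  \<open>A\<close>, computed with parameters from \<open>B\<close>, is at least \<open>n\<close>.
  Consistency of the branches is tested at the leaves, by nonemptiness.\<close>

primrec bin_tree :: "('a \<Rightarrow> 'b \<Rightarrow> bool) \<Rightarrow> nat \<Rightarrow> 'a set \<Rightarrow> 'b set \<Rightarrow> bool" where
  "bin_tree E 0 A B \<longleftrightarrow> A \<noteq> {}"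
| "bin_tree E (Suc n) A B \<longleftrightarrow>
     (\<exists>b\<in>B. bin_tree E n {a\<in>A. E a b} B \<and> bin_tree E n {a\<in>A. \<not> E a b} B)"

text \<open>A half-graph peeled from its first pair: every later \<open>a'\<close> must fail at
  \<open>b\<close> and every later \<open>b'\<close> must hold at \<open>a\<close>. This form lets a
  pair be put in front during an induction on trees.\<close>

primrec ladder :: "('a \<Rightarrow> 'b \<Rightarrow> bool) \<Rightarrow> nat \<Rightarrow> 'a set \<Rightarrow> 'b set \<Rightarrow> bool" where
  "ladder E 0 A B \<longleftrightarrow> True"
| "ladder E (Suc n) A B \<longleftrightarrow>
     (\<exists>a\<in>A. \<exists>b\<in>B. E a b \<and> ladder E n {a'\<in>A. \<not> E a' b} {b'\<in>B. E a b'})"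

lemma bin_tree_mono:
  assumes "bin_tree E n A B" "A \<subseteq> A'" "B \<subseteq> B'"
  shows "bin_tree E n A' B'"
  using assms
proof (induction n arbitrary: A A')
  case 0
  then show ?case by auto
next
  case (Suc n)
  then obtain b where b: "b \<in> B" "bin_tree E n {a\<in>A. E a b} B" "bin_tree E n {a\<in>A. \<not> E a b} B"
    by auto
  have "bin_tree E n {a\<in>A'. E a b} B'" "bin_tree E n {a\<in>A'. \<not> E a b} B'"
    by (rule Suc.IH[OF b(2)] Suc.IH[OF b(3)]; use Suc.prems in blast)+
  then show ?case using b(1) Suc.prems by auto
qed

lemma bin_tree_nonempty: "bin_tree E n A B \<Longrightarrow> A \<noteq> {}"
  by (induction n arbitrary: A) (simp, fastforce)

lemma ladder_mono:
  assumes "ladder E n A B" "A \<subseteq> A'" "B \<subseteq> B'"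
  shows "ladder E n A' B'"
  using assms
proof (induction n arbitrary: A A' B B')
  case 0
  then show ?case by simp
next
  case (Suc n)
  then obtain a b where ab: "a \<in> A" "b \<in> B" "E a b" "ladder E n {a'\<in>A. \<not> E a' b} {b'\<in>B. E a b'}"
    by auto
  have "ladder E n {a'\<in>A'. \<not> E a' b} {b'\<in>B'. E a b'}"
    by (rule Suc.IH[OF ab(4)]; use Suc.prems in blast)
  then show ?case using ab Suc.prems by auto
qed

text \<open>A pigeonhole principle for trees whose nodes are coloured \<open>B\<close> or
  \<open>C\<close>. If the root lies in \<open>B\<close>, either both halves contain a
  \<open>B\<close>-tree one level shorter, which the root joins, or one half already contains the
  full \<open>C\<close>-tree; symmetrically for \<open>C\<close>.\<close>

lemma bin_tree_partition:
  assumes "bin_tree E (m + n) A (B \<union> C)"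
  shows "bin_tree E m A B \<or> bin_tree E n A C"
  using assms
proof (induction "m + n" arbitrary: m n A)
  case 0
  then show ?case by simp
next
  case (Suc s)
  show ?case
  proof (cases "m = 0 \<or> n = 0")
    case True
    then show ?thesis using bin_tree_nonempty[OF Suc.prems] by auto
  next
    case False
    then obtain m' n' where mn: "m = Suc m'" "n = Suc n'" by (meson not0_implies_Suc)
    have s: "s = m' + n" "s = m + n'" using Suc.hyps(2) mn by auto
    from Suc.prems Suc.hyps(2)[symmetric] obtain b where b: "b \<in> B \<union> C"
      "bin_tree E s {a\<in>A. E a b} (B \<union> C)" "bin_tree E s {a\<in>A. \<not> E a b} (B \<union> C)"
      by auto
    have up: "bin_tree E j A D" if "bin_tree E j {a\<in>A. P a} D" for j P D
      using bin_tree_mono[OF that] by auto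
    show ?thesis
    proof (cases "b \<in> B")
      case True
      have "bin_tree E m' {a\<in>A. E a b} B \<or> bin_tree E n {a\<in>A. E a b} C"
        "bin_tree E m' {a\<in>A. \<not> E a b} B \<or> bin_tree E n {a\<in>A. \<not> E a b} C"
        using Suc.hyps(1)[of m' n] b s by auto
      then show ?thesis using up True mn(1) by auto
    next
      case False
      have "bin_tree E m {a\<in>A. E a b} B \<or> bin_tree E n' {a\<in>A. E a b} C"
        "bin_tree E m {a\<in>A. \<not> E a b} B \<or> bin_tree E n' {a\<in>A. \<not> E a b} C"
        using Suc.hyps(1)[of m n'] b s by auto
      then show ?thesis using up False b(1) mn(2) by auto
    qed
  qed
qed

text \<open>The value is \<open>2 ^ (s + 1) - 2\<close>. The sum leaves a monochromatic subtree of
  height \<open>Suc (tree_height s)\<close>: one level is spent on its root \<open>b\<close>, and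
  the rest feeds the induction.\<close>

primrec tree_height :: "nat \<Rightarrow> nat" where
  "tree_height 0 = 0"
| "tree_height (Suc s) = Suc (tree_height s) + Suc (tree_height s)"

text \<open>Colour the nodes of a tree by their relation to one leaf \<open>a\<close>. A monochromatic subtree with
  root \<open>b\<close> lets the pair \<open>(a, b)\<close> be put in front of a ladder found in one of the two halves below
  \<open>b\<close>.\<close>

lemma bin_tree_imp_ladder:
  assumes "bin_tree E (tree_height (p + q)) A B"
  shows "ladder E p A B \<or> ladder (\<lambda>a b. \<not> E a b) q A B"
  using assms
proof (induction "p + q" arbitrary: p q A B)
  case 0
  then show ?case by simp
next
  case (Suc s)
  show ?case
  proof (cases "p = 0 \<or> q = 0")
    case True
    then show ?thesis by auto
  next
    case False
    then obtain p' q' where pq: "p = Suc p'" "q = Suc q'" by (meson not0_implies_Suc)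
    have s: "s = p' + q" "s = p + q'" using Suc.hyps(2) pq by auto
    obtain a where a: "a \<in> A" using bin_tree_nonempty[OF Suc.prems] by auto
    have "bin_tree E (tree_height (Suc s)) A B" using Suc.prems unfolding Suc.hyps(2) .
    then have "bin_tree E (tree_height (Suc s)) A ({b\<in>B. E a b} \<union> {b\<in>B. \<not> E a b})"
      by (rule bin_tree_mono) auto
    then have "bin_tree E (Suc (tree_height s)) A {b\<in>B. E a b} \<or>
        bin_tree E (Suc (tree_height s)) A {b\<in>B. \<not> E a b}"
      unfolding tree_height.simps by (rule bin_tree_partition)
    then show ?thesis
    proof
      \<comment> \<open>All nodes are now adjacent to \<open>a\<close>, so the half failing at the
        root \<open>b\<close> is where a ladder can be continued after \<open>(a, b)\<close>. A
        ladder for the complement found there is kept as it is.\<close>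
      assume "bin_tree E (Suc (tree_height s)) A {b\<in>B. E a b}"
      then obtain b where b: "b \<in> B" "E a b"
        and t: "bin_tree E (tree_height s) {a'\<in>A. \<not> E a' b} {b\<in>B. E a b}" by auto
      have "ladder E p' {a'\<in>A. \<not> E a' b} {b\<in>B. E a b} \<or>
          ladder (\<lambda>a b. \<not> E a b) q {a'\<in>A. \<not> E a' b} {b\<in>B. E a b}"
        using Suc.hyps(1)[OF s(1)] t s(1) by simp
      then show ?thesis
      proof
        assume "ladder E p' {a'\<in>A. \<not> E a' b} {b\<in>B. E a b}"
        then show ?thesis using a b pq(1) by auto
      next
        assume "ladder (\<lambda>a b. \<not> E a b) q {a'\<in>A. \<not> E a' b} {b\<in>B. E a b}"
        from ladder_mono[OF this, of A B] show ?thesis by auto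
      qed
    next
      assume "bin_tree E (Suc (tree_height s)) A {b\<in>B. \<not> E a b}"
      then obtain b where b: "b \<in> B" "\<not> E a b"
        and t: "bin_tree E (tree_height s) {a'\<in>A. E a' b} {b\<in>B. \<not> E a b}" by auto
      have "ladder E p {a'\<in>A. E a' b} {b\<in>B. \<not> E a b} \<or>
          ladder (\<lambda>a b. \<not> E a b) q' {a'\<in>A. E a' b} {b\<in>B. \<not> E a b}"
        using Suc.hyps(1)[OF s(2)] t s(2) by simp
      then show ?thesis
      proof
        assume "ladder (\<lambda>a b. \<not> E a b) q' {a'\<in>A. E a' b} {b\<in>B. \<not> E a b}"
        then show ?thesis using a b pq(2) by auto
      next
        assume "ladder E p {a'\<in>A. E a' b} {b\<in>B. \<not> E a b}"
        from ladder_mono[OF this, of A B] show ?thesis by auto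
      qed
    qed
  qed
qed

text \<open>Translates the recursive ladder into the indexed sequences that occur in
  \<open>k_stable\<close>.\<close>

lemma ladder_sequences:
  assumes "ladder E n A B"
  shows "\<exists>a b. a ` {1..n} \<subseteq> A \<and> b ` {1..n} \<subseteq> B \<and>
           (\<forall>i\<in>{1..n}. \<forall>j\<in>{1..n}. E (a i) (b j) \<longleftrightarrow> i \<le> j)"
  using assms
proof (induction n arbitrary: A B)
  case 0
  then show ?case by simp
next
  case (Suc n)
  then obtain a0 b0 where 0: "a0 \<in> A" "b0 \<in> B" "E a0 b0"
    and "ladder E n {a'\<in>A. \<not> E a' b0} {b'\<in>B. E a0 b'}" by auto
  from Suc.IH[OF this(4)] obtain a b
    where a: "a ` {1..n} \<subseteq> {a'\<in>A. \<not> E a' b0}" and b: "b ` {1..n} \<subseteq> {b'\<in>B. E a0 b'}"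
      and E: "\<forall>i\<in>{1..n}. \<forall>j\<in>{1..n}. E (a i) (b j) \<longleftrightarrow> i \<le> j" by blast
  \<comment> \<open>The outermost pair gets index 1 and the inner ladder moves up by one.\<close>
  define a' where "a' i = (if i = 1 then a0 else a (i - 1))" for i
  define b' where "b' i = (if i = 1 then b0 else b (i - 1))" for i
  have idx: "i = 1 \<or> (i \<noteq> 1 \<and> i - 1 \<in> {1..n})" if "i \<in> {1..Suc n}" for i
    using that by auto
  have "E (a' i) (b' j) \<longleftrightarrow> i \<le> j" if "i \<in> {1..Suc n}" "j \<in> {1..Suc n}" for i j
  proof -
    have "a (i - 1) \<in> {a'\<in>A. \<not> E a' b0}" if "i \<noteq> 1"
      using a idx[OF \<open>i \<in> {1..Suc n}\<close>] that by blast
    moreover have "b (j - 1) \<in> {b'\<in>B. E a0 b'}" if "j \<noteq> 1"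
      using b idx[OF \<open>j \<in> {1..Suc n}\<close>] that by blast
    moreover have "E (a (i - 1)) (b (j - 1)) \<longleftrightarrow> i - 1 \<le> j - 1" if "i \<noteq> 1" "j \<noteq> 1"
      using E idx[OF \<open>i \<in> {1..Suc n}\<close>] idx[OF \<open>j \<in> {1..Suc n}\<close>] that by blast
    ultimately show ?thesis using 0(3) that unfolding a'_def b'_def by auto
  qed
  moreover have "a' i \<in> A \<and> b' i \<in> B" if "i \<in> {1..Suc n}" for i
    using idx[OF that]
  proof
    assume "i \<noteq> 1 \<and> i - 1 \<in> {1..n}"
    then have "a (i - 1) \<in> A" "b (i - 1) \<in> B" using a b by blast+
    then show ?thesis using 0 unfolding a'_def b'_def by simp
  qed (simp add: 0 a'_def b'_def)
  then have "a' ` {1..Suc n} \<subseteq> A" "b' ` {1..Suc n} \<subseteq> B" by blast+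
  ultimately show ?case by blast
qed

text \<open>A tall tree gives a ladder for \<open>E\<close> or one for its complement; the latter
  becomes a ladder for \<open>E\<close> when read backwards, at the cost of one rung. Hence
  \<open>Suc k\<close>.\<close>

lemma no_ladder_imp_no_bin_tree:
  assumes "\<not> (\<exists>a b. a ` {1..k} \<subseteq> A \<and> b ` {1..k} \<subseteq> B \<and>
              (\<forall>i\<in>{1..k}. \<forall>j\<in>{1..k}. E (a i) (b j) \<longleftrightarrow> i \<le> j))"
  shows "\<not> bin_tree E (tree_height (k + Suc k)) A B"
proof
  assume "bin_tree E (tree_height (k + Suc k)) A B"
  then consider "ladder E k A B" | "ladder (\<lambda>a b. \<not> E a b) (Suc k) A B"
    using bin_tree_imp_ladder by blast
  then show False
  proof cases
    case 1
    from ladder_sequences[OF this] assms show False by contradiction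
  next
    case 2
    from ladder_sequences[OF this] obtain a b
      where a: "a ` {1..Suc k} \<subseteq> A" and b: "b ` {1..Suc k} \<subseteq> B"
        and E: "\<forall>i\<in>{1..Suc k}. \<forall>j\<in>{1..Suc k}. \<not> E (a i) (b j) \<longleftrightarrow> i \<le> j" by blast
    \<comment> \<open>In the complement ladder \<open>E (a i) (b j)\<close> means
      \<open>j < i\<close>. Reversing both sequences, with \<open>b\<close> one index below
      \<open>a\<close>, turns this strict inequality into \<open>i \<le> j\<close>.\<close>
    define a' where "a' i = a (Suc (Suc k) - i)" for i
    define b' where "b' j = b (Suc k - j)" for j
    have idx: "Suc (Suc k) - i \<in> {1..Suc k}" "Suc k - i \<in> {1..Suc k}" if "i \<in> {1..k}" for i
      using that by auto
    have E': "E (a' i) (b' j) \<longleftrightarrow> i \<le> j" if "i \<in> {1..k}" "j \<in> {1..k}" for i j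
    proof -
      have "Suc (Suc k) - i \<in> {1..Suc k}" "Suc k - j \<in> {1..Suc k}" using that idx by blast+
      then have "\<not> E (a' i) (b' j) \<longleftrightarrow> Suc (Suc k) - i \<le> Suc k - j"
        using E[rule_format, of "Suc (Suc k) - i" "Suc k - j"] unfolding a'_def b'_def by blast
      then show ?thesis using that by auto
    qed
    have "a' ` {1..k} \<subseteq> A"
      unfolding a'_def using subsetD[OF a imageI[OF idx(1)]] by (rule image_subsetI)
    moreover have "b' ` {1..k} \<subseteq> B"
      unfolding b'_def using subsetD[OF b imageI[OF idx(2)]] by (rule image_subsetI)
    ultimately have "\<exists>a b. a ` {1..k} \<subseteq> A \<and> b ` {1..k} \<subseteq> B \<and>
        (\<forall>i\<in>{1..k}. \<forall>j\<in>{1..k}. E (a i) (b j) \<longleftrightarrow> i \<le> j)"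
      using E' by (intro exI[of _ a'] exI[of _ b'] conjI ballI) simp_all
    with assms show False by contradiction
  qed
qed

section \<open>Atomic sets of a finitely additive measure\<close>

text \<open>Separates the measure argument from logic: what is kept of the setting is an algebra
  containing the fibres of a relation, and a finitely additive measure on it.\<close>

locale relation_content = algebra \<Omega> \<A> for \<Omega> :: "'a set" and \<A> +
  fixes \<mu> :: "'a set \<Rightarrow> real" and E :: "'a \<Rightarrow> 'b \<Rightarrow> bool" and B :: "'b set"
  assumes content_nonneg: "X \<in> \<A> \<Longrightarrow> 0 \<le> \<mu> X"
    and content_Un: "X \<in> \<A> \<Longrightarrow> Y \<in> \<A> \<Longrightarrow> X \<inter> Y = {} \<Longrightarrow> \<mu> (X \<union> Y) = \<mu> X + \<mu> Y"
    and fiber_in: "b \<in> B \<Longrightarrow> {a\<in>\<Omega>. E a b} \<in> \<A>"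
begin

section \<open>Elementary properties of finitely additive measures\<close>

lemma content_empty: "\<mu> {} = 0"
  using content_Un[of "{}" "{}"] by simp

lemma content_Diff: "X \<in> \<A> \<Longrightarrow> Y \<in> \<A> \<Longrightarrow> Y \<subseteq> X \<Longrightarrow> \<mu> (X - Y) = \<mu> X - \<mu> Y"
  using content_Un[of Y "X - Y"] Diff[of X Y] by (simp add: Un_absorb1)

lemma content_mono: "X \<in> \<A> \<Longrightarrow> Y \<in> \<A> \<Longrightarrow> Y \<subseteq> X \<Longrightarrow> \<mu> Y \<le> \<mu> X"
  using content_Diff[of X Y] content_nonneg[of "X - Y"] Diff[of X Y] by simp

text \<open>The truth value \<open>s\<close> selects the fibre or its complement, so that a type can
  later be a function from parameters to truth values.\<close>

lemma side_in:
  assumes "X \<in> \<A>" "b \<in> B"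
  shows "{a\<in>X. E a b = s} \<in> \<A>"
proof -
  have X: "X \<subseteq> \<Omega>" using assms(1) sets_into_space by blast
  have "{a\<in>X. E a b = True} = X \<inter> {a\<in>\<Omega>. E a b}" "{a\<in>X. E a b = False} = X - {a\<in>\<Omega>. E a b}"
    using X by auto
  then show ?thesis using fiber_in[OF assms(2)] assms(1) by (cases s) auto
qed

text \<open>For small \<open>\<delta>\<close>, such a \<open>Y\<close> behaves like a single type of weight \<open>\<alpha>\<close>.\<close>

definition near_atom :: "'a set \<Rightarrow> real \<Rightarrow> real \<Rightarrow> 'a set \<Rightarrow> bool" where
  "near_atom X \<delta> \<alpha> Y \<longleftrightarrow> Y \<in> \<A> \<and> Y \<subseteq> X \<and> \<alpha> \<le> \<mu> Y \<and> \<mu> Y < \<alpha> + \<delta> \<and>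
     (\<forall>b\<in>B. \<exists>s. \<alpha> \<le> \<mu> {a\<in>Y. E a b = s})"

text \<open>The weights \<open>\<alpha>s\<close>, in particular their number, are chosen before \<open>\<delta>\<close>.\<close>

definition atomic :: "'a set \<Rightarrow> bool" where
  "atomic X \<longleftrightarrow> (\<forall>\<epsilon>>0. \<exists>\<alpha>s. (\<forall>\<alpha>\<in>set \<alpha>s. 0 < \<alpha>) \<and> \<mu> X - \<epsilon> < sum_list \<alpha>s \<and>
     (\<forall>\<delta>>0. \<exists>Ys. list_all2 (near_atom X \<delta>) \<alpha>s Ys \<and> sorted_wrt disjnt Ys))"

section \<open>Atomicity and disjoint unions\<close>

lemma near_atom_mono: "near_atom X \<delta> \<alpha> Y \<Longrightarrow> X \<subseteq> X' \<Longrightarrow> near_atom X' \<delta> \<alpha> Y"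
  unfolding near_atom_def by blast

lemma list_all2_near_atom_subset: "list_all2 (near_atom X \<delta>) \<alpha>s Ys \<Longrightarrow> Y \<in> set Ys \<Longrightarrow> Y \<subseteq> X"
  by (auto simp: list_all2_conv_all_nth in_set_conv_nth near_atom_def)

lemma atomic_empty: "atomic {}"
  unfolding atomic_def
  \<comment> \<open>With no weights at all, the empty sum 0 still exceeds
    \<open>- \<epsilon>\<close>.\<close>
  by (intro allI impI exI[of _ "[]"]) (simp add: content_empty)

lemma near_atoms_append:
  assumes "list_all2 (near_atom X \<delta>) \<alpha>s Xs" "sorted_wrt disjnt Xs"
    and "list_all2 (near_atom Y \<delta>) \<beta>s Ys" "sorted_wrt disjnt Ys"
    and "X \<inter> Y = {}"
  shows "list_all2 (near_atom (X \<union> Y) \<delta>) (\<alpha>s @ \<beta>s) (Xs @ Ys) \<and> sorted_wrt disjnt (Xs @ Ys)"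
proof
  have "list_all2 (near_atom (X \<union> Y) \<delta>) \<alpha>s Xs" "list_all2 (near_atom (X \<union> Y) \<delta>) \<beta>s Ys"
    by (rule list_all2_mono[OF assms(1)] list_all2_mono[OF assms(3)]; auto intro: near_atom_mono)+
  then show "list_all2 (near_atom (X \<union> Y) \<delta>) (\<alpha>s @ \<beta>s) (Xs @ Ys)"
    by (rule list_all2_appendI)
  have "disjnt U V" if "U \<in> set Xs" "V \<in> set Ys" for U V
    using list_all2_near_atom_subset[OF assms(1) that(1)]
      list_all2_near_atom_subset[OF assms(3) that(2)] assms(5)
    unfolding disjnt_def by blast
  then show "sorted_wrt disjnt (Xs @ Ys)" using assms(2,4) by (simp add: sorted_wrt_append)
qed

text \<open>Each part receives half of the error. The concatenated weights are fixed before
  \<open>\<delta>\<close>, and disjointness of the parts keeps the two families of near-atoms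
  disjoint.\<close>

lemma atomic_Un:
  assumes "atomic X" "atomic Y" "X \<in> \<A>" "Y \<in> \<A>" "X \<inter> Y = {}"
  shows "atomic (X \<union> Y)"
  unfolding atomic_def
proof (intro allI impI)
  fix \<epsilon> :: real
  assume "\<epsilon> > 0"
  then have e: "\<epsilon> / 2 > 0" by simp
  obtain \<alpha>s where \<alpha>s: "\<forall>\<alpha>\<in>set \<alpha>s. 0 < \<alpha>" "\<mu> X - \<epsilon> / 2 < sum_list \<alpha>s"
    "\<And>\<delta>. \<delta> > 0 \<Longrightarrow> \<exists>Ys. list_all2 (near_atom X \<delta>) \<alpha>s Ys \<and> sorted_wrt disjnt Ys"
    using assms(1) e unfolding atomic_def by blast
  obtain \<beta>s where \<beta>s: "\<forall>\<alpha>\<in>set \<beta>s. 0 < \<alpha>" "\<mu> Y - \<epsilon> / 2 < sum_list \<beta>s"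
    "\<And>\<delta>. \<delta> > 0 \<Longrightarrow> \<exists>Ys. list_all2 (near_atom Y \<delta>) \<beta>s Ys \<and> sorted_wrt disjnt Ys"
    using assms(2) e unfolding atomic_def by blast
  have "\<exists>Ys. list_all2 (near_atom (X \<union> Y) \<delta>) (\<alpha>s @ \<beta>s) Ys \<and> sorted_wrt disjnt Ys"
    if "\<delta> > 0" for \<delta>
    using \<alpha>s(3)[OF that] \<beta>s(3)[OF that] near_atoms_append assms(5) by meson
  moreover have "\<mu> (X \<union> Y) - \<epsilon> < sum_list (\<alpha>s @ \<beta>s)"
    using \<alpha>s(2) \<beta>s(2) content_Un[OF assms(3-5)] by simp
  moreover have "\<forall>\<alpha>\<in>set (\<alpha>s @ \<beta>s). 0 < \<alpha>" using \<alpha>s(1) \<beta>s(1) by auto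
  ultimately show "\<exists>\<alpha>s. (\<forall>\<alpha>\<in>set \<alpha>s. 0 < \<alpha>) \<and> \<mu> (X \<union> Y) - \<epsilon> < sum_list \<alpha>s \<and>
     (\<forall>\<delta>>0. \<exists>Ys. list_all2 (near_atom (X \<union> Y) \<delta>) \<alpha>s Ys \<and> sorted_wrt disjnt Ys)"
    by blast
qed

section \<open>Finite fragments of a possibly inconsistent type \<open>p\<close>\<close>

definition cylinder :: "'a set \<Rightarrow> ('b \<Rightarrow> bool) \<Rightarrow> 'b set \<Rightarrow> 'a set" where
  "cylinder X p F = {a\<in>X. \<forall>b\<in>F. E a b = p b}"

lemma cylinder_insert: "cylinder X p (insert b F) = {a \<in> cylinder X p F. E a b = p b}"
  unfolding cylinder_def by auto

lemma cylinder_in: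
  assumes "finite F" "F \<subseteq> B" "X \<in> \<A>"
  shows "cylinder X p F \<in> \<A>"
  using assms
proof (induction F)
  case empty
  then show ?case by (simp add: cylinder_def)
next
  case (insert b F)
  then show ?case unfolding cylinder_insert by (intro side_in) auto
qed

text \<open>Adding the parameters one at a time, a point outside the cylinder is caught at the first
  parameter where it disagrees with \<open>p\<close>. This splits the difference into finitely many
  disjoint pieces, each inside a side opposite to \<open>p\<close>.\<close>

lemma atomic_Diff_cylinder:
  assumes "finite F" "F \<subseteq> B" "X \<in> \<A>"
    and side: "\<And>b Y. b \<in> B \<Longrightarrow> Y \<in> \<A> \<Longrightarrow> Y \<subseteq> {a\<in>X. E a b = (\<not> p b)} \<Longrightarrow> atomic Y"
  shows "atomic (X - cylinder X p F)"
  using assms(1,2)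
proof (induction F)
  case empty
  then show ?case by (simp add: cylinder_def atomic_empty)
next
  case (insert b F)
  let ?C = "cylinder X p F"
  let ?S = "{a\<in>?C. E a b = (\<not> p b)}"
  have C: "?C \<in> \<A>" "?C \<subseteq> X" using insert cylinder_in assms(3) by (auto simp: cylinder_def)
  then have S: "?S \<in> \<A>" using insert by (intro side_in) auto
  have "atomic ?S" using side[OF _ S] insert.prems C(2) by auto
  then have "atomic ((X - ?C) \<union> ?S)"
    using insert C S assms(3) by (intro atomic_Un) auto
  moreover have "X - cylinder X p (insert b F) = (X - ?C) \<union> ?S"
    using C(2) unfolding cylinder_insert by auto
  ultimately show ?case by simp
qed

text \<open>For each \<open>b\<close>, the side chosen by \<open>p b\<close> is again a cylinder,
  over \<open>insert b F\<close>, so it cannot fall below the lower bound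
  \<open>\<alpha>\<close>.\<close>

lemma near_atom_cylinder:
  assumes X: "X \<in> \<A>" and F: "finite F" "F \<subseteq> B" "\<mu> (cylinder X p F) < \<alpha> + \<delta>"
    and low: "\<And>G. finite G \<Longrightarrow> G \<subseteq> B \<Longrightarrow> \<alpha> \<le> \<mu> (cylinder X p G)"
  shows "near_atom X \<delta> \<alpha> (cylinder X p F)"
  unfolding near_atom_def
proof (intro conjI ballI)
  show "cylinder X p F \<in> \<A>" using cylinder_in F X by blast
  show "cylinder X p F \<subseteq> X" unfolding cylinder_def by auto
  show "\<alpha> \<le> \<mu> (cylinder X p F)" "\<mu> (cylinder X p F) < \<alpha> + \<delta>" using low F by auto
  show "\<exists>s. \<alpha> \<le> \<mu> {a \<in> cylinder X p F. E a b = s}" if "b \<in> B" for b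
    using low[of "insert b F"] F that unfolding cylinder_insert by auto
qed

text \<open>One cylinder of measure close to the weight of \<open>p\<close> is split off; it
  contributes at most one new weight, and the rest of \<open>X\<close> is atomic because it lies in
  finitely many opposite sides.\<close>

lemma atomic_of_sides:
  assumes X: "X \<in> \<A>"
    and side: "\<And>b Y. b \<in> B \<Longrightarrow> Y \<in> \<A> \<Longrightarrow> Y \<subseteq> {a\<in>X. E a b = (\<not> p b)} \<Longrightarrow> atomic Y"
  shows "atomic X"
proof -
  define \<F> where "\<F> = {F. finite F \<and> F \<subseteq> B}"
  define \<alpha> where "\<alpha> = (INF F\<in>\<F>. \<mu> (cylinder X p F))"
  have ne: "\<F> \<noteq> {}" unfolding \<F>_def by auto
  have pos: "0 \<le> \<mu> (cylinder X p F)" if "F \<in> \<F>" for F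
    using that cylinder_in X content_nonneg unfolding \<F>_def by auto
  then have bdd: "bdd_below ((\<lambda>F. \<mu> (cylinder X p F)) ` \<F>)" by (intro bdd_belowI2)
  have low: "\<alpha> \<le> \<mu> (cylinder X p F)" if "finite F" "F \<subseteq> B" for F
    unfolding \<alpha>_def using that bdd by (intro cINF_lower) (auto simp: \<F>_def)
  have appr: "\<exists>F. finite F \<and> F \<subseteq> B \<and> \<mu> (cylinder X p F) < \<alpha> + d" if "d > 0" for d
  proof -
    have "\<exists>F\<in>\<F>. \<mu> (cylinder X p F) < \<alpha> + d"
      using cINF_less_iff[OF ne bdd, of "\<alpha> + d"] that unfolding \<alpha>_def by simp
    then show ?thesis unfolding \<F>_def by auto
  qed
  have \<alpha>0: "0 \<le> \<alpha>" unfolding \<alpha>_def by (intro cINF_greatest ne pos)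
  show ?thesis
    unfolding atomic_def
  proof (intro allI impI)
    fix \<epsilon> :: real
    assume "\<epsilon> > 0"
    then have e: "\<epsilon> / 2 > 0" by simp
    \<comment> \<open>\<open>F\<close> depends on \<open>\<epsilon>\<close> alone. It determines
      \<open>X - ?Y\<close> and thereby the weights, before any \<open>\<delta>\<close> is
      given.\<close>
    obtain F where F: "finite F" "F \<subseteq> B" "\<mu> (cylinder X p F) < \<alpha> + \<epsilon> / 2"
      using appr[OF e] by blast
    let ?Y = "cylinder X p F"
    have Y: "?Y \<in> \<A>" "?Y \<subseteq> X" using cylinder_in F X by (auto simp: cylinder_def)
    have "atomic (X - ?Y)" using atomic_Diff_cylinder F X side by blast
    then obtain \<alpha>s where \<alpha>s: "\<forall>\<alpha>\<in>set \<alpha>s. 0 < \<alpha>" "\<mu> (X - ?Y) - \<epsilon> / 2 < sum_list \<alpha>s"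
      "\<And>\<delta>. \<delta> > 0 \<Longrightarrow> \<exists>Ys. list_all2 (near_atom (X - ?Y) \<delta>) \<alpha>s Ys \<and> sorted_wrt disjnt Ys"
      using e unfolding atomic_def by blast
    \<comment> \<open>Half of the error is lost on \<open>X - ?Y\<close>, the other half on the
      excess of \<open>\<mu> ?Y\<close> over \<open>\<alpha>\<close>.\<close>
    have sum: "\<mu> X - \<epsilon> < sum_list \<alpha>s + \<alpha>"
      using \<alpha>s(2) F(3) content_Diff[OF X Y] by simp
    have XY: "(X - ?Y) \<union> ?Y = X" "(X - ?Y) \<inter> ?Y = {}" using Y(2) by auto
    \<comment> \<open>Weights must be positive, so a type of weight 0 contributes no
      near-atom.\<close>
    define \<beta>s where "\<beta>s = (if \<alpha> = 0 then [] else [\<alpha>])"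
    have \<beta>s: "\<exists>Ys. list_all2 (near_atom ?Y \<delta>) \<beta>s Ys \<and> sorted_wrt disjnt Ys" if "\<delta> > 0" for \<delta>
    proof -
      \<comment> \<open>\<open>G\<close> may depend on \<open>\<delta>\<close>. Passing to
        \<open>F \<union> G\<close> keeps the refined cylinder inside \<open>?Y\<close>, hence
        disjoint from the near-atoms of \<open>X - ?Y\<close>.\<close>
      obtain G where G: "finite G" "G \<subseteq> B" "\<mu> (cylinder X p G) < \<alpha> + \<delta>"
        using appr[OF \<open>\<delta> > 0\<close>] by blast
      have "\<mu> (cylinder X p (F \<union> G)) \<le> \<mu> (cylinder X p G)"
        using F G X by (intro content_mono cylinder_in) (auto simp: cylinder_def)
      then have "near_atom X \<delta> \<alpha> (cylinder X p (F \<union> G))"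
        using F G X low by (intro near_atom_cylinder) auto
      then have "near_atom ?Y \<delta> \<alpha> (cylinder X p (F \<union> G))"
        unfolding near_atom_def by (auto simp: cylinder_def)
      then show ?thesis
        unfolding \<beta>s_def by (cases "\<alpha> = 0") (auto intro!: exI[of _ "[cylinder X p (F \<union> G)]"])
    qed
    have near: "\<exists>Ys. list_all2 (near_atom X \<delta>) (\<alpha>s @ \<beta>s) Ys \<and> sorted_wrt disjnt Ys" if "\<delta> > 0" for \<delta>
    proof -
      obtain Xs where "list_all2 (near_atom (X - ?Y) \<delta>) \<alpha>s Xs" "sorted_wrt disjnt Xs"
        using \<alpha>s(3)[OF \<open>\<delta> > 0\<close>] by blast
      moreover obtain Ys where "list_all2 (near_atom ?Y \<delta>) \<beta>s Ys" "sorted_wrt disjnt Ys"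
        using \<beta>s[OF \<open>\<delta> > 0\<close>] by blast
      ultimately show ?thesis
        using near_atoms_append[OF _ _ _ _ XY(2)] unfolding XY(1) by (intro exI[of _ "Xs @ Ys"])
    qed
    have "\<mu> X - \<epsilon> < sum_list (\<alpha>s @ \<beta>s)" using sum by (simp add: \<beta>s_def)
    moreover have "\<forall>\<alpha>\<in>set (\<alpha>s @ \<beta>s). 0 < \<alpha>" using \<alpha>s(1) \<alpha>0 by (auto simp: \<beta>s_def)
    ultimately show "\<exists>\<alpha>s. (\<forall>\<alpha>\<in>set \<alpha>s. 0 < \<alpha>) \<and> \<mu> X - \<epsilon> < sum_list \<alpha>s \<and>
       (\<forall>\<delta>>0. \<exists>Ys. list_all2 (near_atom X \<delta>) \<alpha>s Ys \<and> sorted_wrt disjnt Ys)"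
      by (intro exI[of _ "\<alpha>s @ \<beta>s"] conjI allI impI near)
  qed
qed

lemma no_bin_tree_imp_atomic:
  assumes "\<not> bin_tree E n X B" "X \<in> \<A>"
  shows "atomic X"
  using assms
proof (induction n arbitrary: X)
  case 0
  then show ?case by (simp add: atomic_empty)
next
  case (Suc n)
  \<comment> \<open>\<open>p\<close> follows a side that still carries a tree of height
    \<open>n\<close>. The opposite side carries none: two such sides would give \<open>X\<close> a
    tree of height \<open>Suc n\<close>, and if the positive side has no tree, it is itself the
    opposite side.\<close>
  define p where "p b \<longleftrightarrow> bin_tree E n {a\<in>X. E a b} B" for b
  show ?case
  proof (rule atomic_of_sides[OF Suc.prems(2), of p])
    fix b Y
    assume b: "b \<in> B" and Y: "Y \<in> \<A>" "Y \<subseteq> {a\<in>X. E a b = (\<not> p b)}"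
    have "\<not> bin_tree E n {a\<in>X. E a b = (\<not> p b)} B"
      using Suc.prems(1) b by (cases "p b") (auto simp: p_def)
    then have "\<not> bin_tree E n Y B" using bin_tree_mono[OF _ Y(2)] by blast
    then show "atomic Y" using Suc.IH Y(1) by blast
  qed
qed

section \<open>From near-atoms to good partitions\<close>

lemma near_atom_dichotomy:
  assumes Y: "near_atom X \<delta> \<alpha> Y" and b: "b \<in> B" and \<delta>: "\<delta> \<le> \<gamma> * \<alpha>"
    and pos: "0 < \<alpha>" "0 < \<gamma>"
  shows "\<mu> {a\<in>Y. E a b} < \<gamma> * \<mu> Y \<or> (1 - \<gamma>) * \<mu> Y < \<mu> {a\<in>Y. E a b}"
proof -
  have Y': "Y \<in> \<A>" "\<alpha> \<le> \<mu> Y" "\<mu> Y < \<alpha> + \<delta>" using Y unfolding near_atom_def by auto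
  \<comment> \<open>Since \<open>\<mu> Y < \<alpha> + \<gamma> * \<alpha>\<close>, removing
    \<open>\<gamma> * \<mu> Y\<close> leaves less than \<open>\<alpha>\<close>. So the side of
    measure at least \<open>\<alpha>\<close> is the large one, and its complement in
    \<open>Y\<close> has measure below \<open>\<gamma> * \<mu> Y\<close>.\<close>
  have key: "(1 - \<gamma>) * \<mu> Y < \<alpha>"
  proof -
    have "\<gamma> * \<alpha> \<le> \<gamma> * \<mu> Y" using Y'(2) pos(2) by simp
    then show ?thesis using Y'(3) \<delta> by (simp add: algebra_simps)
  qed
  have "{a\<in>Y. E a b = False} = Y - {a\<in>Y. E a b = True}" by auto
  then have split: "\<mu> {a\<in>Y. E a b = False} = \<mu> Y - \<mu> {a\<in>Y. E a b = True}"
    using content_Diff[OF Y'(1) side_in[OF Y'(1) b, of True]] by auto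
  from Y b obtain s where s: "\<alpha> \<le> \<mu> {a\<in>Y. E a b = s}" unfolding near_atom_def by blast
  show ?thesis
  proof (cases s)
    case True
    then show ?thesis using s key by simp
  next
    case False
    then show ?thesis using s key split by (simp add: algebra_simps)
  qed
qed

lemma content_UN:
  assumes "\<And>i. i \<in> I \<Longrightarrow> X i \<in> \<A>" "disjoint_family_on X I" "finite I"
  shows "\<mu> (\<Union>i\<in>I. X i) = (\<Sum>i\<in>I. \<mu> (X i))"
  using assms(3,1,2)
proof (induction I)
  case empty
  then show ?case by (simp add: content_empty)
next
  case (insert j I)
  have "X j \<inter> (\<Union>i\<in>I. X i) = {}"
    using insert.prems(2) insert.hyps(2) unfolding disjoint_family_on_def by auto
  then have "\<mu> (X j \<union> (\<Union>i\<in>I. X i)) = \<mu> (X j) + \<mu> (\<Union>i\<in>I. X i)"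
    using insert by (intro content_Un finite_UN) auto
  moreover have "disjoint_family_on X I" using insert.prems(2) unfolding disjoint_family_on_def by auto
  ultimately show ?case using insert by simp
qed

text \<open>The number of weights serves as \<open>m\<close>; it is fixed by
  \<open>\<epsilon>\<close>, while \<open>\<gamma>\<close> enters through the choice of
  \<open>\<delta>\<close>.\<close>

lemma atomic_good_partition:
  assumes "atomic \<Omega>" "0 < \<epsilon>" "0 < \<mu> \<Omega>"
  shows "\<exists>m\<ge>1. \<forall>\<gamma>>0. \<exists>X :: nat \<Rightarrow> 'a set.
           (\<Union>i\<in>{0..m}. X i) = \<Omega> \<and> disjoint_family_on X {0..m} \<and>
           (\<forall>i\<in>{0..m}. X i \<in> \<A>) \<and> \<mu> (X 0) < \<epsilon> \<and>
           (\<forall>i\<in>{1..m}. \<forall>b\<in>B. \<mu> {a \<in> X i. E a b} < \<gamma> * \<mu> (X i) \<or>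
                                 (1 - \<gamma>) * \<mu> (X i) < \<mu> {a \<in> X i. E a b})"
proof -
  \<comment> \<open>Capping the error at \<open>\<mu> \<Omega>\<close> forces a positive sum of
    weights, so there is at least one weight and \<open>m \<ge> 1\<close>.\<close>
  have "0 < min \<epsilon> (\<mu> \<Omega>)" using assms by simp
  then obtain \<alpha>s where \<alpha>s: "\<forall>\<alpha>\<in>set \<alpha>s. 0 < \<alpha>" "\<mu> \<Omega> - min \<epsilon> (\<mu> \<Omega>) < sum_list \<alpha>s"
    "\<And>\<delta>. \<delta> > 0 \<Longrightarrow> \<exists>Ys. list_all2 (near_atom \<Omega> \<delta>) \<alpha>s Ys \<and> sorted_wrt disjnt Ys"
    using assms(1) unfolding atomic_def by blast
  define m where "m = length \<alpha>s"
  have "\<alpha>s \<noteq> []" using \<alpha>s(2) by auto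
  then have m: "m \<ge> 1" unfolding m_def by (simp add: Suc_leI)
  have partition: "\<exists>X :: nat \<Rightarrow> 'a set.
           (\<Union>i\<in>{0..m}. X i) = \<Omega> \<and> disjoint_family_on X {0..m} \<and>
           (\<forall>i\<in>{0..m}. X i \<in> \<A>) \<and> \<mu> (X 0) < \<epsilon> \<and>
           (\<forall>i\<in>{1..m}. \<forall>b\<in>B. \<mu> {a \<in> X i. E a b} < \<gamma> * \<mu> (X i) \<or>
                                 (1 - \<gamma>) * \<mu> (X i) < \<mu> {a \<in> X i. E a b})"
    if \<gamma>: "\<gamma> > 0" for \<gamma>
  proof -
    \<comment> \<open>The least weight makes \<open>\<delta> \<le> \<gamma> * \<alpha>\<close> hold
      for all weights at once.\<close>
    define \<delta> where "\<delta> = \<gamma> * Min (set \<alpha>s)"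
    have "0 < \<delta>" using \<gamma> \<alpha>s(1) \<open>\<alpha>s \<noteq> []\<close> unfolding \<delta>_def by simp
    then obtain Ys where Ys: "list_all2 (near_atom \<Omega> \<delta>) \<alpha>s Ys" "sorted_wrt disjnt Ys"
      using \<alpha>s(3) by blast
    have len: "length Ys = m" using Ys(1) unfolding m_def by (simp add: list_all2_lengthD)
    have near: "near_atom \<Omega> \<delta> (\<alpha>s ! i) (Ys ! i)" if "i < m" for i
      using list_all2_nthD[OF Ys(1)] that unfolding m_def by blast
    define R where "R = (\<Union>i<m. Ys ! i)"
    have Ys_in: "Ys ! i \<in> \<A>" "Ys ! i \<subseteq> \<Omega>" "\<alpha>s ! i \<le> \<mu> (Ys ! i)" if "i < m" for i
      using near[OF that] unfolding near_atom_def by auto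
    have R: "R \<in> \<A>" "R \<subseteq> \<Omega>" using Ys_in unfolding R_def by (auto intro!: finite_UN)
    have disj: "Ys ! i \<inter> Ys ! j = {}" if "i < m" "j < m" "i \<noteq> j" for i j
    proof (cases i j rule: linorder_cases)
      case less
      then show ?thesis using sorted_wrt_nth_less[OF Ys(2)] that len by (simp add: disjnt_def)
    next
      case greater
      then show ?thesis
        using sorted_wrt_nth_less[OF Ys(2) greater] that len by (simp add: disjnt_def Int_commute)
    next
      case equal
      then show ?thesis using that(3) by simp
    qed
    have "sum_list \<alpha>s = (\<Sum>i<m. \<alpha>s ! i)"
      unfolding m_def by (simp add: sum_list_sum_nth atLeast0LessThan)
    also have "\<dots> \<le> (\<Sum>i<m. \<mu> (Ys ! i))" using Ys_in(3) by (intro sum_mono) auto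
    also have "\<dots> = \<mu> R"
      unfolding R_def using Ys_in(1) disj
      by (intro content_UN[symmetric]) (auto simp: disjoint_family_on_def)
    finally have "\<mu> (\<Omega> - R) < \<epsilon>" using \<alpha>s(2) content_Diff[OF top R] by simp
    \<comment> \<open>Index 0 holds the uncovered remainder; the near-atoms are shifted to start at
      1.\<close>
    define X where "X i = (if i = 0 then \<Omega> - R else Ys ! (i - 1))" for i
    have idx: "i - 1 < m" if "i \<in> {0..m}" "i \<noteq> 0" for i using that by auto
    have X_sub: "X i \<subseteq> R" if "i \<in> {0..m}" "i \<noteq> 0" for i
      using idx[OF that] that(2) unfolding R_def X_def by auto
    have "X i \<inter> X j = {}" if "i \<in> {0..m}" "j \<in> {0..m}" "i \<noteq> j" for i j
    proof -
      consider "i = 0" "j \<noteq> 0" | "j = 0" "i \<noteq> 0" | "i \<noteq> 0" "j \<noteq> 0"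
        using \<open>i \<noteq> j\<close> by (cases "i = 0"; cases "j = 0") auto
      then show ?thesis
      proof cases
        case 1
        then show ?thesis using X_sub[OF that(2)] by (auto simp: X_def[of 0])
      next
        case 2
        then show ?thesis using X_sub[OF that(1)] by (auto simp: X_def[of 0])
      next
        case 3
        then show ?thesis using disj[OF idx[OF that(1)] idx[OF that(2)]] that(3) by (simp add: X_def)
      qed
    qed
    then have "disjoint_family_on X {0..m}" unfolding disjoint_family_on_def by simp
    moreover have "(\<Union>i\<in>{0..m}. X i) = \<Omega>"
    proof -
      have "{0..m} = insert 0 (Suc ` {..<m})"
        by (auto simp: image_Suc_lessThan)
      then have "(\<Union>i\<in>{0..m}. X i) = X 0 \<union> (\<Union>i<m. X (Suc i))" by (simp only: UN_insert image_image)
      then have "(\<Union>i\<in>{0..m}. X i) = (\<Omega> - R) \<union> R" by (simp add: X_def R_def)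
      then show ?thesis using R(2) by blast
    qed
    moreover have "\<forall>i\<in>{0..m}. X i \<in> \<A>" using R(1) Ys_in(1)[OF idx] by (simp add: X_def Diff)
    moreover have "\<mu> (X 0) < \<epsilon>" using \<open>\<mu> (\<Omega> - R) < \<epsilon>\<close> unfolding X_def by simp
    moreover have "\<forall>i\<in>{1..m}. \<forall>b\<in>B. \<mu> {a \<in> X i. E a b} < \<gamma> * \<mu> (X i) \<or> (1 - \<gamma>) * \<mu> (X i) < \<mu> {a \<in> X i. E a b}"
    proof (intro ballI)
      fix i b
      assume ib: "i \<in> {1..m}" "b \<in> B"
      have i: "i - 1 < m" "i \<noteq> 0" using ib(1) by auto
      then have mem: "\<alpha>s ! (i - 1) \<in> set \<alpha>s" unfolding m_def by simp
      then have "\<delta> \<le> \<gamma> * (\<alpha>s ! (i - 1))" unfolding \<delta>_def using \<gamma> by simp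
      then show "\<mu> {a \<in> X i. E a b} < \<gamma> * \<mu> (X i) \<or> (1 - \<gamma>) * \<mu> (X i) < \<mu> {a \<in> X i. E a b}"
        using near_atom_dichotomy[OF near[OF i(1)] ib(2)] \<alpha>s(1) mem \<gamma> i(2) by (simp add: X_def)
    qed
    ultimately show ?thesis by (intro exI[of _ X] conjI)
  qed
  show ?thesis by (intro exI[of _ m] conjI allI impI m; rule partition)
qed

end

section \<open>Definable sets\<close>

lemma phi_definable_Diff:
  assumes "phi_definable M \<phi> x y X" "phi_definable M \<phi> x y Y"
  shows "phi_definable M \<phi> x y (X - Y)"
proof -
  obtain \<theta> \<eta> where "set_phi_formula \<theta> \<subseteq> carrier M" "X = {a \<in> carrier M. sat_phi M \<phi> x y a \<theta>}"
    "set_phi_formula \<eta> \<subseteq> carrier M" "Y = {a \<in> carrier M. sat_phi M \<phi> x y a \<eta>}"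
    using assms unfolding phi_definable_def by blast
  then show ?thesis
    unfolding phi_definable_def by (intro exI[of _ "PAnd \<theta> (PNot \<eta>)"]) auto
qed

lemma phi_definable_Un:
  assumes "phi_definable M \<phi> x y X" "phi_definable M \<phi> x y Y"
  shows "phi_definable M \<phi> x y (X \<union> Y)"
proof -
  obtain \<theta> \<eta> where "set_phi_formula \<theta> \<subseteq> carrier M" "X = {a \<in> carrier M. sat_phi M \<phi> x y a \<theta>}"
    "set_phi_formula \<eta> \<subseteq> carrier M" "Y = {a \<in> carrier M. sat_phi M \<phi> x y a \<eta>}"
    using assms unfolding phi_definable_def by blast
  then show ?thesis
    unfolding phi_definable_def by (intro exI[of _ "POr \<theta> \<eta>"]) auto
qed

lemma phi_definable_Inst:
  "b \<in> carrier M \<Longrightarrow> phi_definable M \<phi> x y {a \<in> carrier M. sat2 M \<phi> x y a b}"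
  unfolding phi_definable_def by (intro exI[of _ "Inst b"]) auto

lemma phi_definable_carrier:
  assumes "carrier M \<noteq> {}"
  shows "phi_definable M \<phi> x y (carrier M)"
proof -
  \<comment> \<open>A \<open>phi_formula\<close> is built from instances, so truth is expressed as
    excluded middle for an instance at some element.\<close>
  obtain b where "b \<in> carrier M" using assms by blast
  then show ?thesis
    unfolding phi_definable_def by (intro exI[of _ "POr (Inst b) (PNot (Inst b))"]) auto
qed

lemma algebra_phi_definable:
  assumes "carrier M \<noteq> {}"
  shows "algebra (carrier M) {X. phi_definable M \<phi> x y X}"
  unfolding algebra_iff_Un
proof (intro conjI ballI)
  have "phi_definable M \<phi> x y (carrier M - carrier M)"
    by (rule phi_definable_Diff; rule phi_definable_carrier[OF assms])
  then show "{} \<in> {X. phi_definable M \<phi> x y X}" by simp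
  show "{X. phi_definable M \<phi> x y X} \<subseteq> Pow (carrier M)" unfolding phi_definable_def by auto
qed (auto intro: phi_definable_Un phi_definable_Diff phi_definable_carrier[OF assms])

text \<open>Additivity on disjoint sets is the inclusion-exclusion rule together with
  \<open>\<mu> {} = 0\<close>; the fibres are the sets defined by single instances.\<close>

lemma relation_content_keisler:
  assumes "carrier M \<noteq> {}" "keisler_measure M \<phi> x y \<mu>"
  shows "relation_content (carrier M) {X. phi_definable M \<phi> x y X} \<mu> (sat2 M \<phi> x y) (carrier M)"
proof (intro relation_content.intro relation_content_axioms.intro)
  show "algebra (carrier M) {X. phi_definable M \<phi> x y X}"
    by (rule algebra_phi_definable[OF assms(1)])
qed (use assms(2) phi_definable_Inst in \<open>auto simp: keisler_measure_def\<close>)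

theorem theorem3p6:
  fixes L :: "('f, 'r) language"
    and T :: "('f, 'r) fo_formula set"
    and \<phi> :: "('f, 'r) fo_formula"
    and x y :: nat
    and M :: "('f, 'r, 'a) interp"
    and \<mu> :: "'a set \<Rightarrow> real"
  assumes "countable_language L"
    and "complete_theory TYPE('a) L T"
    and "all_models_infinite TYPE('a) L T"
    and "binary_formula L \<phi> x y"
    and "graph_formula TYPE('a) L T \<phi> x y"
    and "stable_formula TYPE('a) L T \<phi> x y"
    and "is_model L T M"
    and "keisler_measure M \<phi> x y \<mu>"
  shows "\<forall>\<epsilon>::real. \<epsilon> > 0 \<longrightarrow> (\<exists>m::nat. m \<ge> 1 \<and> (\<forall>\<gamma>::real. \<gamma> > 0 \<longrightarrow>
           (\<exists>X :: nat \<Rightarrow> 'a set.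
              (\<Union>i\<in>{0..m}. X i) = carrier M \<and> disjoint_family_on X {0..m} \<and>
              (\<forall>i\<in>{0..m}. phi_definable M \<phi> x y (X i)) \<and>
              \<mu> (X 0) < \<epsilon> \<and>
              (\<forall>i\<in>{1..m}. good M \<phi> x y \<mu> \<gamma> (X i)))))"
proof (intro allI impI)
  fix \<epsilon> :: real
  assume \<epsilon>: "\<epsilon> > 0"
  have ne: "carrier M \<noteq> {}" using assms(7) unfolding is_model_def is_structure_def by blast
  interpret relation_content "carrier M" "{X. phi_definable M \<phi> x y X}" \<mu> "sat2 M \<phi> x y" "carrier M"
    by (rule relation_content_keisler[OF ne assms(8)])
  obtain k where "k_stable TYPE('a) L T k \<phi> x y"
    using assms(6) unfolding stable_formula_def by blast
  \<comment> \<open>Stability is instantiated at \<open>M\<close> itself; the absence of ladders of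
    length \<open>k\<close> then bounds the height of trees on its carrier.\<close>
  then have "\<not> (\<exists>a b :: nat \<Rightarrow> 'a. a ` {1..k} \<subseteq> carrier M \<and> b ` {1..k} \<subseteq> carrier M \<and>
      (\<forall>i\<in>{1..k}. \<forall>j\<in>{1..k}. sat2 M \<phi> x y (a i) (b j) \<longleftrightarrow> i \<le> j))"
    unfolding k_stable_def by (elim allE[of _ M] mp) (rule assms(7))
  then have atomic: "atomic (carrier M)"
    by (rule no_bin_tree_imp_atomic[OF no_ladder_imp_no_bin_tree top])
  \<comment> \<open>The complement rule for the empty set gives total mass 1, hence the positivity
    required for \<open>m \<ge> 1\<close>.\<close>
  have "\<mu> (carrier M - {}) = 1 - \<mu> {}"
    using assms(8) empty_sets unfolding keisler_measure_def by blast
  then have pos: "0 < \<mu> (carrier M)" by (simp add: content_empty)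
  obtain m where "m \<ge> 1" and m: "\<forall>\<gamma>>0. \<exists>X :: nat \<Rightarrow> 'a set.
      (\<Union>i\<in>{0..m}. X i) = carrier M \<and> disjoint_family_on X {0..m} \<and>
      (\<forall>i\<in>{0..m}. X i \<in> {X. phi_definable M \<phi> x y X}) \<and> \<mu> (X 0) < \<epsilon> \<and>
      (\<forall>i\<in>{1..m}. \<forall>b\<in>carrier M. \<mu> {a \<in> X i. sat2 M \<phi> x y a b} < \<gamma> * \<mu> (X i) \<or>
         (1 - \<gamma>) * \<mu> (X i) < \<mu> {a \<in> X i. sat2 M \<phi> x y a b})"
    using atomic_good_partition[OF atomic \<epsilon> pos] by (elim exE conjE) (rule that)
  show "\<exists>m\<ge>1. \<forall>\<gamma>>0. \<exists>X :: nat \<Rightarrow> 'a set.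
              (\<Union>i\<in>{0..m}. X i) = carrier M \<and> disjoint_family_on X {0..m} \<and>
              (\<forall>i\<in>{0..m}. phi_definable M \<phi> x y (X i)) \<and>
              \<mu> (X 0) < \<epsilon> \<and>
              (\<forall>i\<in>{1..m}. good M \<phi> x y \<mu> \<gamma> (X i))"
  proof (intro exI[of _ m] conjI allI impI)
    show "m \<ge> 1" by fact
    fix \<gamma> :: real
    assume "\<gamma> > 0"
    with m obtain X where X: "(\<Union>i\<in>{0..m}. X i) = carrier M" "disjoint_family_on X {0..m}"
      "\<forall>i\<in>{0..m}. X i \<in> {X. phi_definable M \<phi> x y X}" "\<mu> (X 0) < \<epsilon>"
      "\<forall>i\<in>{1..m}. \<forall>b\<in>carrier M. \<mu> {a \<in> X i. sat2 M \<phi> x y a b} < \<gamma> * \<mu> (X i) \<or>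
         (1 - \<gamma>) * \<mu> (X i) < \<mu> {a \<in> X i. sat2 M \<phi> x y a b}"
      by (elim allE[of _ \<gamma>] impE exE conjE) (assumption, rule that)
    have "\<forall>i\<in>{0..m}. phi_definable M \<phi> x y (X i)" using X(3) by simp
    moreover from this have "\<forall>i\<in>{1..m}. good M \<phi> x y \<mu> \<gamma> (X i)"
      using X(5) by (simp add: good_def phi_fiber_def)
    ultimately show "\<exists>X :: nat \<Rightarrow> 'a set.
              (\<Union>i\<in>{0..m}. X i) = carrier M \<and> disjoint_family_on X {0..m} \<and>
              (\<forall>i\<in>{0..m}. phi_definable M \<phi> x y (X i)) \<and>
              \<mu> (X 0) < \<epsilon> \<and>
              (\<forall>i\<in>{1..m}. good M \<phi> x y \<mu> \<gamma> (X i))"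
      using X(1,2,4) by (intro exI[of _ X] conjI)
  qed
qed

end
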